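(* Every PAJ $A$ is a direct product of uniformly generated noncommutative PAJ's (i.e. PAJ's each generated by a set of primitive axes all of which are of type $(\lambda,\delta)$ or $(\delta,\lambda)$ for some pair $\lambda\neq\delta$ with $\lambda+\delta=1$, the pair depending on the factor) with a CPAJ.
   Context: Algebras are not necessarily associative, commutative or unital. $\mathbb F$ is a field of characteristic $\ne 2$ and $A$ is an $\mathbb F$-algebra. For an idempotent $a\in A$ put $A_0(a)=\{y\in A: ay=ya=0\}$ and $A_{\lambda,\delta}(a)=\{y\in A: ay=\lambda y,\ ya=\delta y\}$. For $\lambda,\delta\in\mathbb F\setminus\{0,1\}$, a primitive axis of type $(\lambda,\delta)$ is a nonzero idempotent $a\in A$ with $\{y:ay=y\}=\mathbb Fa=\{y:ya=y\}$, such that $A=\mathbb Fa\oplus A_0(a)\oplus A_{\lambda,\delta}(a)$ and this is a $\mathbb Z_2$-grading with even part $\mathbb Fa\oplus A_0(a)$ and odd part $A_{\lambda,\delta}(a)$. If $\lambda=\delta$ the type is called commutative; if $\lambda\neq\delta$ it is called noncommutative, and then $\lambda+\delta=1$ (a known fact, taken as a convention). Each primitive axis is regarded as carrying exactly one type (if $A_{\lambda,\delta}(a)=0$, a fixed choice is made). A PAJ is an algebra generated by a set of primitive axes (possibly of different types). A CPAJ is a commutative PAJ. "Direct product" of a family of subalgebras means that the algebra is their internal direct sum as vector spaces and that distinct factors multiply to zero; for infinitely many factors this is the restricted (finite-support) product. The family of noncommutative factors may be empty and the CPAJ factor may be zero. *)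

theory Defs
  imports Complex_Main
begin

locale nonassoc_algebra = vector_space scale
  for scale :: "'f::field \<Rightarrow> 'a::ab_group_add \<Rightarrow> 'a" (infixr "*s" 75) +
  fixes mult :: "'a \<Rightarrow> 'a \<Rightarrow> 'a" (infixl "\<odot>" 70)
  assumes mult_add_left: "(x + y) \<odot> z = x \<odot> z + y \<odot> z"
    and mult_add_right: "x \<odot> (y + z) = x \<odot> y + x \<odot> z"
    and mult_scale_left: "(c *s x) \<odot> y = c *s (x \<odot> y)"
    and mult_scale_right: "x \<odot> (c *s y) = c *s (x \<odot> y)"
begin

definition subalgebra :: "'a set \<Rightarrow> bool" where
  "subalgebra B \<longleftrightarrow> subspace B \<and> (\<forall>x\<in>B. \<forall>y\<in>B. x \<odot> y \<in> B)"

text \<open>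
  The carrier \<open>B\<close> below is the algebra in which the notions are taken: either the whole
  type or a subalgebra regarded as an algebra in its own right.
\<close>

definition eigenspace :: "'a set \<Rightarrow> 'f \<Rightarrow> 'f \<Rightarrow> 'a \<Rightarrow> 'a set" where
  "eigenspace B l d a = {y \<in> B. a \<odot> y = l *s y \<and> y \<odot> a = d *s y}"

definition zero_part :: "'a set \<Rightarrow> 'a \<Rightarrow> 'a set" where
  "zero_part B a = {y \<in> B. a \<odot> y = 0 \<and> y \<odot> a = 0}"

definition even_part :: "'a set \<Rightarrow> 'a \<Rightarrow> 'a set" where
  "even_part B a = {p + z | p z. p \<in> span {a} \<and> z \<in> zero_part B a}"

text \<open>
  Bijectivity of the sum map says that \<open>B\<close> is the internal direct sum of the line through
  \<open>a\<close>, the zero part and the \<open>(l, d)\<close>-eigenspace.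
\<close>

definition primitive_axis :: "'a set \<Rightarrow> 'f \<Rightarrow> 'f \<Rightarrow> 'a \<Rightarrow> bool" where
  "primitive_axis B l d a \<longleftrightarrow>
     l \<notin> {0, 1} \<and> d \<notin> {0, 1} \<and>
     a \<in> B \<and> a \<noteq> 0 \<and> a \<odot> a = a \<and>
     {y \<in> B. a \<odot> y = y} = span {a} \<and> {y \<in> B. y \<odot> a = y} = span {a} \<and>
     bij_betw (\<lambda>(p, z, w). p + z + w)
       (span {a} \<times> zero_part B a \<times> eigenspace B l d a) B \<and>
     (\<forall>x\<in>even_part B a. \<forall>y\<in>even_part B a. x \<odot> y \<in> even_part B a) \<and>
     (\<forall>x\<in>even_part B a. \<forall>y\<in>eigenspace B l d a. x \<odot> y \<in> eigenspace B l d a) \<and>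
     (\<forall>x\<in>eigenspace B l d a. \<forall>y\<in>even_part B a. x \<odot> y \<in> eigenspace B l d a) \<and>
     (\<forall>x\<in>eigenspace B l d a. \<forall>y\<in>eigenspace B l d a. x \<odot> y \<in> even_part B a)"

definition PAJ :: "'a set \<Rightarrow> bool" where
  "PAJ B \<longleftrightarrow> subalgebra B \<and>
     (\<exists>X. (\<forall>a\<in>X. \<exists>l d. primitive_axis B l d a) \<and> subalgebra hull X = B)"

definition CPAJ :: "'a set \<Rightarrow> bool" where
  "CPAJ B \<longleftrightarrow> PAJ B \<and> (\<forall>x\<in>B. \<forall>y\<in>B. x \<odot> y = y \<odot> x)"

text \<open>
  The type of a primitive axis is determined by the axis unless its eigenspace is zero, in which
  case every admissible pair fits. A typing selects one type for each primitive axis.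
\<close>

definition axis_typing :: "'a set \<Rightarrow> ('a \<Rightarrow> 'f \<times> 'f) \<Rightarrow> bool" where
  "axis_typing B ty \<longleftrightarrow>
     (\<forall>a. (\<exists>l d. primitive_axis B l d a) \<longrightarrow> primitive_axis B (fst (ty a)) (snd (ty a)) a)"

definition uniform_noncomm_PAJ :: "('a \<Rightarrow> 'f \<times> 'f) \<Rightarrow> 'a set \<Rightarrow> bool" where
  "uniform_noncomm_PAJ ty B \<longleftrightarrow> subalgebra B \<and>
     (\<exists>l d. l \<noteq> d \<and> l + d = 1 \<and>
       (\<exists>X. (\<forall>a\<in>X. primitive_axis B (fst (ty a)) (snd (ty a)) a \<and> ty a \<in> {(l, d), (d, l)}) \<and>
            subalgebra hull X = B))"

text \<open>
  The factors form a set rather than an indexed family; this loses nothing, since nonzero members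
  of a direct sum are pairwise distinct. The functions \<open>f\<close> are the finitely supported choices of
  one component per factor, and bijectivity of the sum map is the internal direct sum condition.
\<close>

definition direct_product :: "'a set \<Rightarrow> 'a set set \<Rightarrow> bool" where
  "direct_product B \<F> \<longleftrightarrow>
     (\<forall>S\<in>\<F>. subalgebra S) \<and>
     bij_betw (\<lambda>f. \<Sum>S | f S \<noteq> 0. f S)
       {f. (\<forall>S\<in>\<F>. f S \<in> S) \<and> (\<forall>S. S \<notin> \<F> \<longrightarrow> f S = 0) \<and> finite {S. f S \<noteq> 0}} B \<and>
     (\<forall>S\<in>\<F>. \<forall>T\<in>\<F>. S \<noteq> T \<longrightarrow> (\<forall>x\<in>S. \<forall>y\<in>T. x \<odot> y = 0))"

end

end

theory Submission
  imports Defs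
begin

text \<open>
  The Miyamoto involution of an axis (negating its odd part) is an automorphism, so it permutes the
  primitive axes; as the odd component of \<open>b\<close> is half the difference of \<open>b\<close> and its image, every set
  of axes closed under these involutions spans a subalgebra. In particular a PAJ is spanned by its
  primitive axes. For two axes \<open>a\<close>, \<open>b\<close> with \<open>ab \<noteq> ba\<close> the odd components of each with respect to the
  other are proportional, which forces the types to be equal or opposite with eigenvalue sum 1. A
  commuting pair of distinct axes, one of them noncentral, has product zero. Hence the spans of the
  noncentral axes of type \<open>(l, d)\<close> or \<open>(d, l)\<close>, together with the span of the central axes,
  annihilate one another and sum to the algebra.

  The overlap of one factor with the sum of the others lies in the annihilator of the algebra, which
  need not vanish on the central part, but does meet every noncentral factor trivially. Among
  noncentral axes of one fixed type, \<open>ab \<noteq> ba \<or> a = b\<close> is an equivalence relation, and the operator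
  \<open>x \<mapsto> (l ax - d xa) / (l - d)\<close> projects onto the span of the class of \<open>a\<close>; so an element \<open>x\<close> of the
  span of these axes can be recovered from the products \<open>ax\<close>, \<open>xa\<close>.
\<close>

context nonassoc_algebra
begin

section \<open>Bilinearity, spans and generated subalgebras\<close>

lemma mult_zero_left [simp]: "0 \<odot> x = 0"
  using mult_add_left[of 0 0 x] by simp

lemma mult_zero_right [simp]: "x \<odot> 0 = 0"
  using mult_add_right[of x 0 0] by simp

lemma mult_minus_left: "(- x) \<odot> y = - (x \<odot> y)"
  using mult_add_left[of x "- x" y] by (simp add: eq_neg_iff_add_eq_0 add.commute)

lemma mult_minus_right: "x \<odot> (- y) = - (x \<odot> y)"
  using mult_add_right[of x y "- y"] by (simp add: eq_neg_iff_add_eq_0 add.commute)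

lemma mult_diff_left: "(x - y) \<odot> z = x \<odot> z - y \<odot> z"
  using mult_add_left[of x "- y" z] by (simp add: mult_minus_left)

lemma mult_diff_right: "x \<odot> (y - z) = x \<odot> y - x \<odot> z"
  using mult_add_right[of x y "- z"] by (simp add: mult_minus_right)

lemmas mult_linear = mult_add_left mult_add_right mult_scale_left mult_scale_right
  mult_diff_left mult_diff_right mult_minus_left mult_minus_right

lemma mult_sum_left: "(\<Sum>i\<in>I. f i) \<odot> x = (\<Sum>i\<in>I. f i \<odot> x)"
  by (induction I rule: infinite_finite_induct) (simp_all add: mult_add_left)

lemma mult_sum_right: "x \<odot> (\<Sum>i\<in>I. f i) = (\<Sum>i\<in>I. x \<odot> f i)"
  by (induction I rule: infinite_finite_induct) (simp_all add: mult_add_right)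

lemma span_mult_induct:
  assumes "x \<in> span X" "y \<in> span Y" "subspace W"
    and "\<And>a b. a \<in> X \<Longrightarrow> b \<in> Y \<Longrightarrow> a \<odot> b \<in> W"
  shows "x \<odot> y \<in> W"
proof -
  have left: "a \<odot> y \<in> W" if "a \<in> X" for a
    using assms(2)
  proof (induction rule: span_induct_alt)
    case base
    then show ?case using assms(3) by (simp add: subspace_0)
  next
    case (step c b y)
    then show ?case
      using assms(3) assms(4)[OF that] by (simp add: mult_linear subspace_add subspace_scale)
  qed
  show ?thesis
    using assms(1)
  proof (induction rule: span_induct_alt)
    case base
    then show ?case using assms(3) by (simp add: subspace_0)
  next
    case (step c b y)
    then show ?case using assms(3) left by (simp add: mult_linear subspace_add subspace_scale)
  qed
qed

lemma subalgebra_UNIV: "subalgebra UNIV"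
  by (simp add: subalgebra_def)

lemma subalgebra_span:
  assumes "\<And>a b. a \<in> X \<Longrightarrow> b \<in> X \<Longrightarrow> a \<odot> b \<in> span X"
  shows "subalgebra (span X)"
  using span_mult_induct[OF _ _ subspace_span assms] by (simp add: subalgebra_def)

lemma hull_eq_span:
  assumes "subalgebra (span X)"
  shows "subalgebra hull X = span X"
proof (rule hull_unique)
  show "X \<subseteq> span X" by (rule span_superset)
  show "span X \<subseteq> B" if "X \<subseteq> B" "subalgebra B" for B
    using that span_minimal by (auto simp: subalgebra_def)
qed (fact assms)

section \<open>Decomposition with respect to an axis\<close>

text \<open>The component on the axis is recorded by its coefficient, so that scalars can be
  compared by uniqueness. No carrier occurs: membership of \<open>z\<close> and \<open>w\<close> in
  a subalgebra is stated separately where it matters.\<close>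

definition axis_components :: "'f \<Rightarrow> 'f \<Rightarrow> 'a \<Rightarrow> 'a \<Rightarrow> 'f \<Rightarrow> 'a \<Rightarrow> 'a \<Rightarrow> bool" where
  "axis_components l d a x c z w \<longleftrightarrow> x = c *s a + z + w \<and>
     a \<odot> z = 0 \<and> z \<odot> a = 0 \<and> a \<odot> w = l *s w \<and> w \<odot> a = d *s w"

text \<open>Left multiplication by \<open>a\<close> acts on the three summands with eigenvalues 1, 0
  and \<open>l\<close>. Applying it once and twice to the relation and subtracting leaves a nonzero
  multiple of \<open>w\<close>.\<close>

lemma eigen_independent:
  assumes "l \<notin> {0, 1}" "a \<odot> a = a" "a \<odot> z = 0" "a \<odot> w = l *s w"
    and sum0: "c *s a + z + w = 0"
  shows "c *s a = 0 \<and> z = 0 \<and> w = 0"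
proof -
  have 1: "c *s a + l *s w = 0"
    using arg_cong[OF sum0, of "\<lambda>x. a \<odot> x"] assms(2-4) by (simp add: mult_linear)
  have 2: "c *s a + (l * l) *s w = 0"
    using arg_cong[OF 1, of "\<lambda>x. a \<odot> x"] assms(2-4) by (simp add: mult_linear)
  have "(l * l - l) *s w = (c *s a + (l * l) *s w) - (c *s a + l *s w)"
    by (simp add: scale_left_diff_distrib)
  also have "\<dots> = 0" using 1 2 by simp
  finally have "(l * (l - 1)) *s w = 0" by (simp add: algebra_simps)
  then have w: "w = 0" using assms(1) by simp
  with 1 have "c *s a = 0" by (simp del: scale_eq_0_iff)
  with w sum0 show ?thesis by (simp del: scale_eq_0_iff)
qed

text \<open>Injectivity of the sum map comes from \<open>eigen_independent\<close>, so the direct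
  sum condition reduces to the existence of components; idempotence of \<open>a\<close> reduces each
  condition on the eigenvalue 1 to one inclusion.\<close>

lemma primitive_axis_iff:
  assumes B: "subalgebra B"
  shows "primitive_axis B l d a \<longleftrightarrow>
     l \<notin> {0, 1} \<and> d \<notin> {0, 1} \<and> a \<in> B \<and> a \<noteq> 0 \<and> a \<odot> a = a \<and>
     (\<forall>y\<in>B. a \<odot> y = y \<longrightarrow> y \<in> span {a}) \<and> (\<forall>y\<in>B. y \<odot> a = y \<longrightarrow> y \<in> span {a}) \<and>
     (\<forall>x\<in>B. \<exists>c. \<exists>z\<in>B. \<exists>w\<in>B. axis_components l d a x c z w) \<and>
     (\<forall>x\<in>even_part B a. \<forall>y\<in>even_part B a. x \<odot> y \<in> even_part B a) \<and>
     (\<forall>x\<in>even_part B a. \<forall>y\<in>eigenspace B l d a. x \<odot> y \<in> eigenspace B l d a) \<and>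
     (\<forall>x\<in>eigenspace B l d a. \<forall>y\<in>even_part B a. x \<odot> y \<in> eigenspace B l d a) \<and>
     (\<forall>x\<in>eigenspace B l d a. \<forall>y\<in>eigenspace B l d a. x \<odot> y \<in> even_part B a)"
proof -
  have line: "({y \<in> B. a \<odot> y = y} = span {a}) = (\<forall>y\<in>B. a \<odot> y = y \<longrightarrow> y \<in> span {a})"
    "({y \<in> B. y \<odot> a = y} = span {a}) = (\<forall>y\<in>B. y \<odot> a = y \<longrightarrow> y \<in> span {a})"
    if "a \<in> B" "a \<odot> a = a"
    using that B by (auto simp: span_singleton mult_linear subalgebra_def subspace_scale)
  have "bij_betw (\<lambda>(p, z, w). p + z + w) (span {a} \<times> zero_part B a \<times> eigenspace B l d a) B
      \<longleftrightarrow> (\<forall>x\<in>B. \<exists>c. \<exists>z\<in>B. \<exists>w\<in>B. axis_components l d a x c z w)" (is "?bij \<longleftrightarrow> ?dec")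
    if a: "a \<in> B" "a \<odot> a = a" and l: "l \<notin> {0, 1}"
  proof
    assume bij: ?bij
    show ?dec
    proof
      fix x assume "x \<in> B"
      then have "x \<in> (\<lambda>(p, z, w). p + z + w) ` (span {a} \<times> zero_part B a \<times> eigenspace B l d a)"
        using bij by (simp add: bij_betw_def)
      then show "\<exists>c. \<exists>z\<in>B. \<exists>w\<in>B. axis_components l d a x c z w"
        by (auto simp: span_singleton zero_part_def eigenspace_def axis_components_def)
    qed
  next
    assume dec: ?dec
    show ?bij
      unfolding bij_betw_def
    proof
      show "inj_on (\<lambda>(p, z, w). p + z + w) (span {a} \<times> zero_part B a \<times> eigenspace B l d a)"
      proof (rule inj_onI, clarsimp)
        fix p z w p' z' w'
        assume p: "p \<in> span {a}" "p' \<in> span {a}" and z: "z \<in> zero_part B a" "z' \<in> zero_part B a"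
          and w: "w \<in> eigenspace B l d a" "w' \<in> eigenspace B l d a"
          and eq: "p + z + w = p' + z' + w'"
        obtain c where c: "p - p' = c *s a"
          using span_diff[OF p] by (auto simp: span_singleton)
        have "c *s a + (z - z') + (w - w') = (p + z + w) - (p' + z' + w')"
          unfolding c[symmetric] by simp
        then have "c *s a + (z - z') + (w - w') = 0" using eq by simp
        then have "p - p' = 0 \<and> z - z' = 0 \<and> w - w' = 0"
          using eigen_independent[OF l a(2), of "z - z'" "w - w'" c] z w c
          unfolding c[symmetric]
          by (simp add: zero_part_def eigenspace_def mult_linear scale_right_diff_distrib)
        then show "p = p' \<and> z = z' \<and> w = w'" by simp
      qed
      show "(\<lambda>(p, z, w). p + z + w) ` (span {a} \<times> zero_part B a \<times> eigenspace B l d a) = B"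
      proof
        show "(\<lambda>(p, z, w). p + z + w) ` (span {a} \<times> zero_part B a \<times> eigenspace B l d a) \<subseteq> B"
          using B a by (auto simp: span_singleton zero_part_def eigenspace_def subalgebra_def
              intro!: subspace_add subspace_scale)
      next
        show "B \<subseteq> (\<lambda>(p, z, w). p + z + w) ` (span {a} \<times> zero_part B a \<times> eigenspace B l d a)"
        proof
          fix x assume "x \<in> B"
          with dec obtain c z w where *: "z \<in> B" "w \<in> B" "axis_components l d a x c z w"
            by blast
          then have "(c *s a, z, w) \<in> span {a} \<times> zero_part B a \<times> eigenspace B l d a"
            by (auto simp: axis_components_def span_singleton zero_part_def eigenspace_def)
          then show "x \<in> (\<lambda>(p, z, w). p + z + w) ` (span {a} \<times> zero_part B a \<times> eigenspace B l d a)"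
            using * by (force simp: axis_components_def)
        qed
      qed
    qed
  qed
  then show ?thesis
    unfolding primitive_axis_def using line by blast
qed

abbreviation typed_axis :: "'f \<Rightarrow> 'f \<Rightarrow> 'a \<Rightarrow> bool" where
  "typed_axis \<equiv> primitive_axis UNIV"

abbreviation odd_part :: "'f \<Rightarrow> 'f \<Rightarrow> 'a \<Rightarrow> 'a set" where
  "odd_part \<equiv> eigenspace UNIV"

lemmas typed_axis_iff = primitive_axis_iff[OF subalgebra_UNIV, simplified]

lemma typed_axisD:
  assumes "typed_axis l d a"
  shows "l \<noteq> 0" "l \<noteq> 1" "d \<noteq> 0" "d \<noteq> 1" "a \<noteq> 0" "a \<odot> a = a"
  using assms by (auto simp: typed_axis_iff)

lemma axis_components_exist:
  assumes "typed_axis l d a"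
  obtains c z w where "axis_components l d a x c z w"
  using assms unfolding typed_axis_iff by blast

lemma axis_components_unique:
  assumes a: "typed_axis l d a"
    and x: "axis_components l d a x c z w" "axis_components l d a x c' z' w'"
  shows "c = c' \<and> z = z' \<and> w = w'"
proof -
  have "(c - c') *s a + (z - z') + (w - w') = (c *s a + z + w) - (c' *s a + z' + w')"
    by (simp add: algebra_simps)
  also have "\<dots> = 0" using x by (simp add: axis_components_def)
  finally show ?thesis
    using eigen_independent[of l a "z - z'" "w - w'" "c - c'"] x typed_axisD[OF a]
    by (simp add: axis_components_def mult_linear scale_right_diff_distrib)
qed

lemma axis_components_mult:
  assumes "typed_axis l d a" "axis_components l d a x c z w"
  shows "a \<odot> x = c *s a + l *s w" "x \<odot> a = c *s a + d *s w"
  using assms typed_axisD[OF assms(1)] by (simp_all add: axis_components_def mult_linear)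

lemma even_part_UNIV: "x \<in> even_part UNIV a \<longleftrightarrow> (\<exists>c z. x = c *s a + z \<and> a \<odot> z = 0 \<and> z \<odot> a = 0)"
  by (auto simp: even_part_def span_singleton zero_part_def)

lemma even_part_components:
  "x \<in> even_part UNIV a \<longleftrightarrow> (\<exists>c z. axis_components l d a x c z 0)"
  by (auto simp: even_part_UNIV axis_components_def)

lemma odd_part_components:
  "w \<in> odd_part l d a \<longleftrightarrow> axis_components l d a w 0 0 w"
  by (auto simp: eigenspace_def axis_components_def)

lemma subspace_even_part: "subspace (even_part UNIV a)"
proof (rule subspaceI)
  show "0 \<in> even_part UNIV a"
    unfolding even_part_UNIV by (intro exI[of _ 0]) simp
next
  fix x y assume "x \<in> even_part UNIV a" "y \<in> even_part UNIV a"
  then obtain c z c' z' where "x = c *s a + z" "a \<odot> z = 0" "z \<odot> a = 0"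
    "y = c' *s a + z'" "a \<odot> z' = 0" "z' \<odot> a = 0" unfolding even_part_UNIV by blast
  then show "x + y \<in> even_part UNIV a"
    unfolding even_part_UNIV
    by (intro exI[of _ "c + c'"] exI[of _ "z + z'"]) (simp add: mult_linear algebra_simps)
next
  fix k x assume "x \<in> even_part UNIV a"
  then obtain c z where "x = c *s a + z" "a \<odot> z = 0" "z \<odot> a = 0" unfolding even_part_UNIV by blast
  then show "k *s x \<in> even_part UNIV a"
    unfolding even_part_UNIV
    by (intro exI[of _ "k * c"] exI[of _ "k *s z"]) (simp add: mult_linear algebra_simps)
qed

lemma subspace_odd_part: "subspace (odd_part l d a)"
  by (rule subspaceI) (auto simp: eigenspace_def mult_linear algebra_simps)

lemma even_odd_zero:
  assumes "typed_axis l d a" "x \<in> even_part UNIV a" "x \<in> odd_part l d a"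
  shows "x = 0"
  using axis_components_unique[OF assms(1)] assms(2,3)
  unfolding even_part_components[of _ _ l d] odd_part_components by metis

lemma even_odd_eq:
  assumes a: "typed_axis l d a" and "x \<in> even_part UNIV a" "x' \<in> even_part UNIV a"
    "y \<in> odd_part l d a" "y' \<in> odd_part l d a" and eq: "x + y = x' + y'"
  shows "x = x' \<and> y = y'"
proof -
  have "x - x' = y' - y" using eq by (simp add: algebra_simps)
  moreover have "x - x' \<in> even_part UNIV a" "y' - y \<in> odd_part l d a"
    using assms subspace_diff[OF subspace_even_part] subspace_diff[OF subspace_odd_part] by auto
  ultimately show ?thesis using even_odd_zero[OF a, of "x - x'"] by simp
qed

lemma fusion:
  assumes "typed_axis l d a"
  shows "x \<in> even_part UNIV a \<Longrightarrow> y \<in> even_part UNIV a \<Longrightarrow> x \<odot> y \<in> even_part UNIV a"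
    and "x \<in> even_part UNIV a \<Longrightarrow> y \<in> odd_part l d a \<Longrightarrow> x \<odot> y \<in> odd_part l d a"
    and "x \<in> odd_part l d a \<Longrightarrow> y \<in> even_part UNIV a \<Longrightarrow> x \<odot> y \<in> odd_part l d a"
    and "x \<in> odd_part l d a \<Longrightarrow> y \<in> odd_part l d a \<Longrightarrow> x \<odot> y \<in> even_part UNIV a"
  using assms unfolding typed_axis_iff by blast+

lemma even_odd_exist:
  assumes "typed_axis l d a"
  obtains e w where "x = e + w" "e \<in> even_part UNIV a" "w \<in> odd_part l d a"
proof -
  obtain c z w where "axis_components l d a x c z w"
    using axis_components_exist[OF assms] .
  then show thesis
    by (intro that[of "c *s a + z" w]) (auto simp: axis_components_def even_part_UNIV eigenspace_def)
qed

text \<open>The components of an element \<open>x\<close> of \<open>B\<close> stay in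
  \<open>B\<close>: \<open>l *s w\<close> equals \<open>a \<odot> x - c *s a\<close>, and
  \<open>l\<close> is invertible. Thus axes of the whole algebra remain axes of the factors, which
  makes the factors PAJs in their own right.\<close>

lemma typed_axis_restrict:
  assumes a: "typed_axis l d a" and B: "subalgebra B" "a \<in> B"
  shows "primitive_axis B l d a"
proof -
  have sub: "subspace B" and mult: "\<And>x y. x \<in> B \<Longrightarrow> y \<in> B \<Longrightarrow> x \<odot> y \<in> B"
    using B by (auto simp: subalgebra_def)
  have even: "even_part B a = even_part UNIV a \<inter> B"
  proof
    show "even_part B a \<subseteq> even_part UNIV a \<inter> B"
    proof
      fix x assume "x \<in> even_part B a"
      then obtain c z where "x = c *s a + z" "z \<in> B" "a \<odot> z = 0" "z \<odot> a = 0"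
        by (auto simp: even_part_def zero_part_def span_singleton)
      then show "x \<in> even_part UNIV a \<inter> B"
        using sub B(2) by (auto simp: even_part_UNIV intro: subspace_add subspace_scale)
    qed
    show "even_part UNIV a \<inter> B \<subseteq> even_part B a"
    proof
      fix x assume x: "x \<in> even_part UNIV a \<inter> B"
      then obtain c z where z: "x = c *s a + z" "a \<odot> z = 0" "z \<odot> a = 0"
        by (auto simp: even_part_UNIV)
      then have "z = x - c *s a" by simp
      then have "z \<in> B" using x B(2) sub by (auto intro!: subspace_diff subspace_scale)
      then show "x \<in> even_part B a"
        using z by (auto simp: even_part_def zero_part_def span_singleton)
    qed
  qed
  have odd: "eigenspace B l d a = odd_part l d a \<inter> B"
    by (auto simp: eigenspace_def)
  have "\<exists>c. \<exists>z\<in>B. \<exists>w\<in>B. axis_components l d a x c z w" if "x \<in> B" for x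
  proof -
    obtain c z w where x: "axis_components l d a x c z w"
      using axis_components_exist[OF a] .
    have "l *s w = a \<odot> x - c *s a" using axis_components_mult[OF a x] by simp
    then have "l *s w \<in> B"
      using mult[OF B(2) that] B(2) sub by (auto intro!: subspace_diff subspace_scale)
    then have "inverse l *s l *s w \<in> B" by (rule subspace_scale[OF sub])
    then have w: "w \<in> B" using typed_axisD[OF a] by simp
    have "z = x - c *s a - w" using x by (simp add: axis_components_def)
    then have "z \<in> B" using w that B(2) sub by (auto intro!: subspace_diff subspace_scale)
    with w x show ?thesis by blast
  qed
  then show ?thesis
    using a fusion[OF a] B mult unfolding primitive_axis_iff[OF B(1)] even odd
    by (simp add: typed_axis_iff)
qed

text \<open>The odd component \<open>w\<close> of \<open>x\<close> for the first type is nonzero,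
  since otherwise \<open>a\<close> and \<open>x\<close> would commute. It is an eigenvector with
  eigenvalues \<open>l\<close> and \<open>d\<close>, and as \<open>l\<close> is neither 0 nor 1 it
  must be odd for the second type too.\<close>

lemma type_unique:
  assumes a: "typed_axis l d a" "typed_axis l' d' a" and "a \<odot> x \<noteq> x \<odot> a"
  shows "l = l' \<and> d = d'"
proof -
  obtain c z w where x: "axis_components l d a x c z w"
    using axis_components_exist[OF a(1)] .
  have "w \<noteq> 0" using assms(3) axis_components_mult[OF a(1) x] by auto
  obtain c' z' w' where w: "axis_components l' d' a w c' z' w'"
    using axis_components_exist[OF a(2)] .
  have w_eigen: "a \<odot> w = l *s w" "w \<odot> a = d *s w"
    using x by (simp_all add: axis_components_def)
  \<comment> \<open>\<open>l *s w\<close> is decomposed twice: by scaling the decomposition of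
    \<open>w\<close>, and by computing \<open>a \<odot> w\<close> from it.\<close>
  have "axis_components l' d' a (l *s w) (l * c') (l *s z') (l *s w')"
    using w by (simp add: axis_components_def mult_linear algebra_simps)
  moreover have "axis_components l' d' a (l *s w) c' 0 (l' *s w')"
    using w_eigen axis_components_mult[OF a(2) w] w by (simp add: axis_components_def mult_linear algebra_simps)
  ultimately have *: "l * c' = c'" "l *s z' = 0" "l *s w' = l' *s w'"
    using axis_components_unique[OF a(2)] by blast+
  then have "c' = 0" "z' = 0" using typed_axisD[OF a(1)] by auto
  then have ww: "w = w'" using w by (simp add: axis_components_def)
  then have "d *s w' = d' *s w'" using w_eigen w by (simp add: axis_components_def)
  then show ?thesis using * \<open>w \<noteq> 0\<close> ww by simp
qed

text \<open>
  The eigenvalues of left multiplication by \<open>a\<close> are \<open>1\<close>, \<open>0\<close> and \<open>l\<close>; the polynomial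
  \<open>t\<^sup>2 - t\<close> vanishes at the first two, which isolates the odd component.
\<close>

definition odd_component :: "'f \<Rightarrow> 'a \<Rightarrow> 'a \<Rightarrow> 'a" where
  "odd_component l a x = inverse (l * l - l) *s (a \<odot> (a \<odot> x) - a \<odot> x)"

lemma odd_component_eq:
  assumes a: "typed_axis l d a" and x: "axis_components l d a x c z w"
  shows "odd_component l a x = w"
proof -
  have "a \<odot> w = l *s w" using x by (simp add: axis_components_def)
  then have "a \<odot> (a \<odot> x) - a \<odot> x = (l * l - l) *s w"
    using axis_components_mult[OF a x] typed_axisD[OF a] by (simp add: mult_linear algebra_simps)
  moreover have "l * l - l \<noteq> 0"
    using typed_axisD[OF a] by simp
  ultimately show ?thesis by (simp add: odd_component_def)
qed

section \<open>Miyamoto involutions\<close>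

text \<open>Defined through multiplications by \<open>a\<close> instead of chosen components, the
  involution is linear by unfolding and depends on the type only through \<open>l\<close>.\<close>

definition miyamoto :: "'f \<Rightarrow> 'a \<Rightarrow> 'a \<Rightarrow> 'a" where
  "miyamoto l a x = x - 2 *s odd_component l a x"

lemma miyamoto_eq:
  assumes "typed_axis l d a" "e \<in> even_part UNIV a" "w \<in> odd_part l d a"
  shows "miyamoto l a (e + w) = e - w"
proof -
  obtain c z where "e = c *s a + z" "a \<odot> z = 0" "z \<odot> a = 0"
    using assms(2) unfolding even_part_UNIV by blast
  then have "axis_components l d a (e + w) c z w"
    using assms(3) by (simp add: axis_components_def eigenspace_def)
  then have "odd_component l a (e + w) = w"
    by (rule odd_component_eq[OF assms(1)])
  moreover have "2 *s w = w + w" using scale_left_distrib[of 1 1 w] by simp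
  ultimately show ?thesis by (simp add: miyamoto_def)
qed

lemma miyamoto_add: "miyamoto l a (x + y) = miyamoto l a x + miyamoto l a y"
  by (simp add: miyamoto_def odd_component_def mult_linear algebra_simps)

lemma miyamoto_scale: "miyamoto l a (c *s x) = c *s miyamoto l a x"
  by (simp add: miyamoto_def odd_component_def mult_linear algebra_simps)

text \<open>By the grading, the even part of \<open>x \<odot> y\<close> is
  \<open>e \<odot> e' + w \<odot> w'\<close> and the odd part is the sum of the mixed products.
  Negating the odd parts of both factors changes the sign of exactly the latter.\<close>

lemma miyamoto_mult:
  assumes a: "typed_axis l d a"
  shows "miyamoto l a (x \<odot> y) = miyamoto l a x \<odot> miyamoto l a y"
proof -
  obtain e w where x: "x = e + w" "e \<in> even_part UNIV a" "w \<in> odd_part l d a"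
    using even_odd_exist[OF a] .
  obtain e' w' where y: "y = e' + w'" "e' \<in> even_part UNIV a" "w' \<in> odd_part l d a"
    using even_odd_exist[OF a] .
  have even: "e \<odot> e' + w \<odot> w' \<in> even_part UNIV a"
    using fusion[OF a] x y by (auto intro: subspace_add[OF subspace_even_part])
  have odd: "e \<odot> w' + w \<odot> e' \<in> odd_part l d a"
    using fusion[OF a] x y by (auto intro: subspace_add[OF subspace_odd_part])
  have xy: "x \<odot> y = (e \<odot> e' + w \<odot> w') + (e \<odot> w' + w \<odot> e')"
    using x y by (simp add: mult_linear)
  show ?thesis
    unfolding xy miyamoto_eq[OF a even odd]
    unfolding x(1) y(1) miyamoto_eq[OF a x(2,3)] miyamoto_eq[OF a y(2,3)]
    by (simp add: mult_linear)
qed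

lemma miyamoto_involution:
  assumes a: "typed_axis l d a"
  shows "miyamoto l a (miyamoto l a x) = x"
proof -
  obtain e w where x: "x = e + w" "e \<in> even_part UNIV a" "w \<in> odd_part l d a"
    using even_odd_exist[OF a] .
  have w: "- w \<in> odd_part l d a" using x subspace_neg[OF subspace_odd_part] by blast
  show ?thesis
    using miyamoto_eq[OF a x(2,3)] miyamoto_eq[OF a x(2) w] x(1) by simp
qed

text \<open>Since \<open>g\<close> is its own inverse, an element lies in a part belonging to
  \<open>g b\<close> iff its image lies in the corresponding part of \<open>b\<close>; so each
  condition for \<open>g b\<close> turns into one for \<open>b\<close>.\<close>

lemma involutive_automorphism_axis:
  assumes add: "\<And>x y. g (x + y) = g x + g y" and scale: "\<And>c x. g (c *s x) = c *s g x"
    and mult: "\<And>x y. g (x \<odot> y) = g x \<odot> g y" and inv: "\<And>x. g (g x) = x"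
    and b: "typed_axis l d b"
  shows "typed_axis l d (g b)"
proof -
  have zero: "g 0 = 0" using scale[of 0 0] by simp
  have inj: "g x = g y \<longleftrightarrow> x = y" for x y by (metis inv)
  have comps: "axis_components l d (g b) (g x) c (g z) (g w)"
    if "axis_components l d b x c z w" for b x c z w
    using that unfolding axis_components_def
    by (auto simp: add scale zero mult[symmetric])
  have comps_iff: "axis_components l d (g b) x c z w \<longleftrightarrow> axis_components l d b (g x) c (g z) (g w)"
    for x c z w
    using comps[of "g b" x c z w] comps[of b "g x" c "g z" "g w"] by (auto simp: inv)
  have even: "x \<in> even_part UNIV (g b) \<longleftrightarrow> g x \<in> even_part UNIV b" for x
    unfolding even_part_components[of _ _ l d] comps_iff zero using inv by metis
  have odd: "x \<in> odd_part l d (g b) \<longleftrightarrow> g x \<in> odd_part l d b" for x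
    unfolding odd_part_components comps_iff zero by simp
  have line: "y \<in> span {g b} \<longleftrightarrow> g y \<in> span {b}" for y
  proof -
    have "y = k *s g b \<longleftrightarrow> g y = k *s b" for k
      using inj[of y "k *s g b"] by (simp add: scale inv)
    then show ?thesis by (auto simp: span_singleton)
  qed
  show ?thesis
    unfolding typed_axis_iff even odd line
  proof (intro conjI)
    show "l \<noteq> 0" "l \<noteq> 1" "d \<noteq> 0" "d \<noteq> 1" "g b \<noteq> 0" "g b \<odot> g b = g b"
      using typed_axisD[OF b] inj[of b 0] zero by (simp_all add: mult[symmetric])
    show "\<forall>y. g b \<odot> y = y \<longrightarrow> g y \<in> span {b}" "\<forall>y. y \<odot> g b = y \<longrightarrow> g y \<in> span {b}"
      using b inj[of "g b \<odot> _"] inj[of "_ \<odot> g b"] by (auto simp: typed_axis_iff mult inv)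
    show "\<forall>x. \<exists>c z w. axis_components l d (g b) x c z w"
    proof
      fix x
      obtain c z w where "axis_components l d b (g x) c z w" using axis_components_exist[OF b] .
      then show "\<exists>c z w. axis_components l d (g b) x c z w"
        using comps[of b "g x" c z w] by (auto simp: inv)
    qed
  qed (auto simp: even odd mult intro: fusion[OF b])
qed

lemma typed_axis_miyamoto:
  assumes "typed_axis l d a" "typed_axis l' d' b"
  shows "typed_axis l' d' (miyamoto l a b)"
  by (rule involutive_automorphism_axis[OF miyamoto_add miyamoto_scale miyamoto_mult[OF assms(1)]
        miyamoto_involution[OF assms(1)] assms(2)])

text \<open>Only commutation is asked for; the centre of a nonassociative algebra usually requires
  associativity conditions as well.\<close>

definition central :: "'a \<Rightarrow> bool" where
  "central a \<longleftrightarrow> (\<forall>x. a \<odot> x = x \<odot> a)"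

lemma central_miyamoto:
  assumes "typed_axis l d a"
  shows "central (miyamoto l a b) \<longleftrightarrow> central b"
  unfolding central_def by (metis assms miyamoto_involution miyamoto_mult)

section \<open>The span of the axes\<close>

text \<open>\<open>b - miyamoto l a b\<close> is twice the odd component; halving it uses that the
  characteristic is not 2.\<close>

lemma odd_component_span:
  assumes "(2::'f) \<noteq> 0" "b \<in> X" "miyamoto l a b \<in> X"
  shows "odd_component l a b \<in> span X"
proof -
  have "b - miyamoto l a b \<in> span X" using assms by (intro span_diff span_base)
  then have "inverse 2 *s (b - miyamoto l a b) \<in> span X" by (rule span_scale)
  then show ?thesis using assms(1) by (simp add: miyamoto_def)
qed

lemma axis_mult_span:
  assumes "(2::'f) \<noteq> 0" "typed_axis l d a" "a \<in> X" "b \<in> X" "miyamoto l a b \<in> X"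
  shows "a \<odot> b \<in> span X"
proof -
  obtain c z w where b: "axis_components l d a b c z w"
    using axis_components_exist[OF assms(2)] .
  have "w \<in> span X" using odd_component_span[OF assms(1,4,5)] odd_component_eq[OF assms(2) b] by simp
  then show ?thesis
    unfolding axis_components_mult(1)[OF assms(2) b]
    using assms(3) by (auto intro: span_add span_scale span_base)
qed

definition axes :: "'a set" where
  "axes = {a. \<exists>l d. typed_axis l d a}"

lemma PAJ_span_axes:
  assumes two: "(2::'f) \<noteq> 0" and "PAJ UNIV"
  shows "span axes = UNIV"
proof -
  have "a \<odot> b \<in> span axes" if ab: "a \<in> axes" "b \<in> axes" for a b
  proof -
    obtain l d l' d' where "typed_axis l d a" "typed_axis l' d' b" using ab by (auto simp: axes_def)
    then show ?thesis
      using axis_mult_span[OF two, of l d a axes b] typed_axis_miyamoto ab unfolding axes_def by blast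
  qed
  then have sub: "subalgebra (span axes)" by (rule subalgebra_span)
  obtain X where "X \<subseteq> axes" "subalgebra hull X = UNIV"
    using assms(2) by (auto simp: PAJ_def axes_def)
  moreover have "subalgebra hull X \<subseteq> span axes"
    using sub span_superset[of axes] \<open>X \<subseteq> axes\<close> by (intro hull_minimal) auto
  ultimately show ?thesis by auto
qed

section \<open>Products of two axes\<close>

text \<open>Since \<open>v \<odot> v\<close> is even, the odd parts of the two eigenvector equations
  read \<open>z \<odot> v = l' *s v\<close> and \<open>v \<odot> z = d' *s v\<close>. The odd part
  of \<open>b \<odot> b = b\<close> is \<open>z \<odot> v + v \<odot> z = v\<close>.\<close>

lemma odd_eigenvalues_sum:
  assumes a: "typed_axis l d a" and b: "b \<odot> b = b" "b = z + v"
    and z: "z \<in> even_part UNIV a" and v: "v \<in> odd_part l d a" "v \<noteq> 0"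
    and bv: "b \<odot> v = l' *s v" "v \<odot> b = d' *s v"
  shows "l' + d' = 1"
proof -
  note vv = fusion(4)[OF a v(1) v(1)] and zero = subspace_0[OF subspace_even_part]
    and zv_odd = fusion(2)[OF a z v(1)] and vz_odd = fusion(3)[OF a v(1) z]
    and scaled = subspace_scale[OF subspace_odd_part v(1)]
  have "v \<odot> v + z \<odot> v = 0 + l' *s v"
    using bv(1) b(2) by (simp add: mult_linear add.commute)
  then have zv: "z \<odot> v = l' *s v"
    using even_odd_eq[OF a vv zero zv_odd scaled] by simp
  have "v \<odot> v + v \<odot> z = 0 + d' *s v"
    using bv(2) b(2) by (simp add: mult_linear add.commute)
  then have vz: "v \<odot> z = d' *s v"
    using even_odd_eq[OF a vv zero vz_odd scaled] by simp
  have "(z \<odot> z + v \<odot> v) + (z \<odot> v + v \<odot> z) = z + v"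
    using b by (simp add: mult_linear algebra_simps)
  then have "z \<odot> v + v \<odot> z = v"
    using even_odd_eq[OF a subspace_add[OF subspace_even_part fusion(1)[OF a z z] vv] z
        subspace_add[OF subspace_odd_part zv_odd vz_odd] v(1)] by simp
  then have "(l' + d') *s v = 1 *s v"
    using zv vz by (simp add: scale_left_distrib)
  then show ?thesis using v(2) by (simp only: scale_cancel_right) simp
qed

text \<open>Decomposing each axis with respect to the other gives odd components \<open>v\<close>
  and \<open>u\<close>, proportional because both are multiples of the commutator. Then
  \<open>\<alpha> *s a - \<beta> *s b = \<kappa> *s v\<close>; the types are opposite when
  \<open>\<kappa>\<close> vanishes and equal when it does not.\<close>

lemma noncommuting_axes:
  assumes a: "typed_axis l d a" and b: "typed_axis l' d' b" and ab: "a \<odot> b \<noteq> b \<odot> a"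
  shows "l \<noteq> d \<and> l + d = 1 \<and>
    (l' = l \<and> d' = d \<and> b - a \<in> odd_part l d a \<or>
     l' = d \<and> d' = l \<and> a \<odot> b = l *s odd_component l a b \<and> b \<odot> a = d *s odd_component l a b)"
proof -
  note aD = typed_axisD[OF a] and bD = typed_axisD[OF b]
  obtain \<alpha> z v where v: "axis_components l d a b \<alpha> z v"
    using axis_components_exist[OF a] .
  obtain \<beta> z' u where u: "axis_components l' d' b a \<beta> z' u"
    using axis_components_exist[OF b] .
  note prod_a = axis_components_mult[OF a v] and prod_b = axis_components_mult[OF b u]
  have oddv: "odd_component l a b = v" by (rule odd_component_eq[OF a v])
  have diff: "(l - d) *s v = a \<odot> b - b \<odot> a"
    unfolding prod_a by (simp add: scale_left_diff_distrib)
  have "(d' - l') *s u = a \<odot> b - b \<odot> a"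
    unfolding prod_b by (simp add: scale_left_diff_distrib)
  with diff have comm: "(l - d) *s v = (d' - l') *s u" by simp
  have ne: "(l - d) *s v \<noteq> 0" unfolding diff using ab by simp
  then have ld: "l \<noteq> d" and v0: "v \<noteq> 0" by auto
  have ld': "l' \<noteq> d'" and u0: "u \<noteq> 0" using ne unfolding comm by auto
  define \<gamma> where "\<gamma> = (l - d) / (d' - l')"
  have "(d' - l') *s u = (d' - l') *s \<gamma> *s v"
    using comm ld' by (simp add: \<gamma>_def)
  then have uv: "u = \<gamma> *s v" using ld' by (metis eq_iff_diff_eq_0 scale_cancel_left)
  have \<gamma>0: "\<gamma> \<noteq> 0" using uv u0 by auto
  define \<kappa> where "\<kappa> = d' * \<gamma> - l"
  have \<kappa>': "\<kappa> = l' * \<gamma> - d"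
  proof -
    have "(d' - l') * \<gamma> = l - d" using ld' by (simp add: \<gamma>_def)
    then show ?thesis by (simp add: \<kappa>_def algebra_simps)
  qed
  \<comment> \<open>Here \<open>a \<odot> b\<close> is computed from the decomposition of
    \<open>b\<close> with respect to \<open>a\<close> and from that of \<open>a\<close> with respect
    to \<open>b\<close>.\<close>
  have \<kappa>: "\<alpha> *s a - \<beta> *s b = \<kappa> *s v"
  proof -
    have "\<alpha> *s a + l *s v = \<beta> *s b + (d' * \<gamma>) *s v"
      using trans[OF prod_a(1)[symmetric] prod_b(2)] by (simp only: uv scale_scale)
    then have "(\<alpha> *s a + l *s v) - l *s v - \<beta> *s b = (d' * \<gamma>) *s v - l *s v" by simp
    then show ?thesis by (simp add: \<kappa>_def scale_left_diff_distrib)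
  qed
  have bcomp: "b = \<alpha> *s a + z + v" and acomp: "a = \<beta> *s b + z' + \<gamma> *s v"
    using u v uv by (simp_all add: axis_components_def)
  have av: "a \<odot> v = l *s v" "v \<odot> a = d *s v" and az: "a \<odot> z = 0" "z \<odot> a = 0"
    using v by (auto simp: axis_components_def)
  have "b \<odot> \<gamma> *s v = l' *s \<gamma> *s v" "\<gamma> *s v \<odot> b = d' *s \<gamma> *s v"
    and bz': "b \<odot> z' = 0" "z' \<odot> b = 0"
    using u uv by (auto simp: axis_components_def)
  then have "\<gamma> *s (b \<odot> v) = \<gamma> *s l' *s v" "\<gamma> *s (v \<odot> b) = \<gamma> *s d' *s v"
    by (simp_all add: mult_linear mult.commute)
  then have bv: "b \<odot> v = l' *s v" "v \<odot> b = d' *s v"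
    using \<gamma>0 by (simp_all only: scale_cancel_left simp_thms)
  \<comment> \<open>The relation for \<open>\<kappa>\<close> decomposes \<open>\<beta> *s b\<close>
    with respect to \<open>a\<close>, and scaling the decomposition of \<open>b\<close> gives
    another. Equating the two, and likewise for \<open>\<alpha> *s a\<close> with respect to
    \<open>b\<close>, yields equations for the scalars.\<close>
  have "\<beta> *s b = \<alpha> *s a - \<kappa> *s v" using \<kappa> by (simp add: algebra_simps)
  then have "axis_components l d a (\<beta> *s b) \<alpha> 0 (- \<kappa> *s v)"
    using av by (simp add: axis_components_def mult_linear mult.commute)
  moreover have "axis_components l d a (\<beta> *s b) (\<beta> * \<alpha>) (\<beta> *s z) (\<beta> *s v)"
    using v by (simp add: axis_components_def mult_linear algebra_simps)
  ultimately have 1: "\<beta> * \<alpha> = \<alpha>" "\<beta> *s z = 0" "\<beta> *s v = - \<kappa> *s v"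
    using axis_components_unique[OF a] by blast+
  have \<beta>\<kappa>: "\<beta> = - \<kappa>" by (rule scale_right_imp_eq[OF v0 1(3)])
  have "\<alpha> *s a = \<beta> *s b + \<kappa> *s v" using \<kappa> by (simp add: algebra_simps)
  then have "axis_components l' d' b (\<alpha> *s a) \<beta> 0 (\<kappa> *s v)"
    using bv by (simp add: axis_components_def mult_linear mult.commute)
  moreover have "axis_components l' d' b (\<alpha> *s a) (\<alpha> * \<beta>) (\<alpha> *s z') (\<alpha> *s u)"
    using u by (simp add: axis_components_def mult_linear algebra_simps)
  ultimately have 2: "\<alpha> * \<beta> = \<beta>" "\<alpha> *s u = \<kappa> *s v"
    using axis_components_unique[OF b] by blast+
  have \<alpha>\<kappa>: "\<alpha> * \<gamma> = \<kappa>" using 2(2) v0 by (simp add: uv)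
  show ?thesis
  proof (cases "\<kappa> = 0")
    \<comment> \<open>Here \<open>\<alpha> = \<beta> = 1\<close> and \<open>z = 0\<close>, so
      \<open>b = a + v\<close>. The odd part of \<open>b \<odot> b = b\<close> gives
      \<open>l + d = 1\<close>, and the two formulas for \<open>\<kappa>\<close> then give
      \<open>l' = l\<close> and \<open>d' = d\<close>.\<close>
    case False
    then have "\<beta> \<noteq> 0" "\<alpha> \<noteq> 0" using \<beta>\<kappa> \<alpha>\<kappa> by auto
    then have "\<alpha> = 1" "\<beta> = 1" "z = 0" using 1 2 by auto
    then have ones: "\<kappa> = -1" "\<gamma> = -1" using \<beta>\<kappa> \<alpha>\<kappa> by (metis minus_minus, metis minus_minus mult_1)
    have b_eq: "b = a + v" using bcomp \<open>\<alpha> = 1\<close> \<open>z = 0\<close> by simp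
    have "v \<odot> v + (l *s v + d *s v) = 0 + v"
      using bD(6) aD(6) av unfolding b_eq by (simp add: mult_linear algebra_simps)
    moreover have v_odd: "v \<in> odd_part l d a" using av by (simp add: eigenspace_def)
    moreover have "l *s v + d *s v \<in> odd_part l d a"
      using v_odd by (intro subspace_add subspace_scale subspace_odd_part)
    ultimately have "l *s v + d *s v = v"
      using even_odd_eq[OF a fusion(4)[OF a v_odd v_odd] subspace_0[OF subspace_even_part]] by blast
    then have "(l + d) *s v = 1 *s v" by (simp add: scale_left_distrib)
    then have sum: "l + d = 1" using v0 by (simp only: scale_cancel_right) simp
    have "d' + l = 1" "l' + d = 1" using ones \<kappa>' \<kappa>_def by (auto simp: algebra_simps)
    then have "l' = l" "d' = d" using sum by (metis add.commute add_left_cancel)+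
    moreover have "b - a \<in> odd_part l d a" using b_eq v_odd by simp
    ultimately show ?thesis using ld sum by blast
  next
    \<comment> \<open>Now \<open>b = z + v\<close> and \<open>a = z' + u\<close>, so
      \<open>odd_eigenvalues_sum\<close> applies in both directions. The formulas for
      \<open>\<kappa>\<close> make \<open>(l, d)\<close> equal to \<open>\<gamma>\<close> times
      \<open>(d', l')\<close>; both pairs sum to 1, so \<open>\<gamma> = 1\<close>.\<close>
    case True
    then have "\<beta> = 0" "\<alpha> = 0" using \<beta>\<kappa> \<alpha>\<kappa> \<gamma>0 by auto
    have zeven: "z \<in> even_part UNIV a" "z' \<in> even_part UNIV b"
      using az bz' unfolding even_part_UNIV by (metis add_0 scale_zero_left)+
    have "l' + d' = 1"
      by (rule odd_eigenvalues_sum[OF a bD(6) _ zeven(1) _ v0 bv])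
        (use bcomp \<open>\<alpha> = 0\<close> av in \<open>auto simp: eigenspace_def\<close>)
    moreover have "l + d = 1"
    proof (rule odd_eigenvalues_sum[OF b aD(6) _ zeven(2) _ u0])
      show "a = z' + u" using acomp uv \<open>\<beta> = 0\<close> by simp
      show "u \<in> odd_part l' d' b" using u by (simp add: axis_components_def eigenspace_def)
      show "a \<odot> u = l *s u" "u \<odot> a = d *s u"
        using av by (simp_all add: uv mult_linear mult.commute)
    qed
    moreover have ld_eq: "l = d' * \<gamma>" "d = l' * \<gamma>" using True \<kappa>' \<kappa>_def by simp_all
    ultimately have "\<gamma> = 1" by (metis add.commute distrib_right mult_1)
    then have "l' = d" "d' = l" using ld_eq by auto
    then show ?thesis
      using ld \<open>l + d = 1\<close> prod_a \<open>\<alpha> = 0\<close> oddv by simp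
  qed
qed

text \<open>As \<open>l \<noteq> d\<close>, commuting forces the odd component of \<open>b\<close>
  to vanish, so \<open>a \<odot> b = \<alpha> *s a\<close>. If \<open>\<alpha>\<close> were nonzero,
  comparing two decompositions of \<open>\<alpha> *s a\<close> with respect to \<open>b\<close>
  would make \<open>a\<close> either a multiple of \<open>b\<close>, hence equal to
  \<open>b\<close>, or an odd element for \<open>b\<close>.\<close>

lemma commuting_axes:
  assumes a: "typed_axis l d a" and b: "typed_axis l' d' b" and ld: "l \<noteq> d"
    and ab: "a \<odot> b = b \<odot> a" and neq: "a \<noteq> b"
  shows "a \<odot> b = 0"
proof -
  note aD = typed_axisD[OF a] and bD = typed_axisD[OF b]
  obtain \<alpha> z v where v: "axis_components l d a b \<alpha> z v"
    using axis_components_exist[OF a] .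
  obtain \<beta> z' u where u: "axis_components l' d' b a \<beta> z' u"
    using axis_components_exist[OF b] .
  have "l *s v = d *s v"
    using axis_components_mult[OF a v] ab by (simp del: scale_cancel_right)
  then have "v = 0" using ld by auto
  then have prod: "a \<odot> b = \<alpha> *s a" "\<alpha> *s a = \<beta> *s b + d' *s u"
    using axis_components_mult[OF a v] axis_components_mult[OF b u] ab by simp_all
  have "axis_components l' d' b (\<alpha> *s a) \<beta> 0 (d' *s u)"
    using prod(2) u by (simp add: axis_components_def mult_linear mult.commute)
  moreover have "axis_components l' d' b (\<alpha> *s a) (\<alpha> * \<beta>) (\<alpha> *s z') (\<alpha> *s u)"
    using u by (simp add: axis_components_def mult_linear algebra_simps)
  ultimately have 1: "\<alpha> * \<beta> = \<beta>" "\<alpha> *s z' = 0" "\<alpha> *s u = d' *s u"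
    using axis_components_unique[OF b] by blast+
  have "\<alpha> = 0"
  proof (rule ccontr)
    assume "\<alpha> \<noteq> 0"
    then have "z' = 0" using 1 by simp
    then have acomp: "a = \<beta> *s b + u" using u by (simp add: axis_components_def)
    show False
    proof (cases "u = 0")
      case True
      then have ab': "a = \<beta> *s b" using acomp by simp
      then have "\<beta> *s a = a" using aD(6) bD(6) by (simp add: mult_linear)
      then have "\<beta> *s a = 1 *s a" by simp
      then have "\<beta> = 1" using aD(5) by (simp only: scale_cancel_right) simp
      then show False using ab' neq by simp
    next
      case False
      then have "\<alpha> = d'" using 1(3) by simp
      then have "\<beta> = 0" using 1(1) bD by simp
      \<comment> \<open>An odd idempotent is also even, being its own square.\<close>
      then have "a \<in> odd_part l' d' b" using acomp u by (simp add: axis_components_def eigenspace_def)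
      moreover from this have "a \<in> even_part UNIV b" using fusion(4)[OF b] aD(6) by metis
      ultimately show False using even_odd_zero[OF b] aD(5) by blast
    qed
  qed
  then show ?thesis using prod by simp
qed

section \<open>Noncentral axes of one type\<close>

text \<open>By \<open>type_unique\<close>, a noncentral axis lies in only one of these sets.\<close>

definition noncentral_axes :: "'f \<Rightarrow> 'f \<Rightarrow> 'a set" where
  "noncentral_axes l d = {a. typed_axis l d a \<and> \<not> central a}"

text \<open>The elements commuting with \<open>a\<close> form a subspace, so a noncentral axis fails
  to commute with some axis, and \<open>noncommuting_axes\<close> applies to that pair.\<close>

lemma noncentral_type:
  assumes "span axes = UNIV" "a \<in> noncentral_axes l d"
  shows "l \<noteq> d \<and> l + d = 1"
proof -
  have a: "typed_axis l d a" "\<not> central a" using assms(2) by (auto simp: noncentral_axes_def)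
  have "\<exists>b\<in>axes. a \<odot> b \<noteq> b \<odot> a"
  proof (rule ccontr)
    assume "\<not> ?thesis"
    moreover have "subspace {x. a \<odot> x = x \<odot> a}"
      by (rule subspaceI) (auto simp: mult_linear)
    ultimately have "span axes \<subseteq> {x. a \<odot> x = x \<odot> a}" by (intro span_minimal) auto
    then show False using a(2) assms(1) by (auto simp: central_def)
  qed
  then show ?thesis using noncommuting_axes[OF a(1)] by (auto simp: axes_def)
qed

definition axis_proj :: "'f \<Rightarrow> 'f \<Rightarrow> 'a \<Rightarrow> 'a \<Rightarrow> 'a" where
  "axis_proj l d a x = inverse (l - d) *s (l *s (a \<odot> x) - d *s (x \<odot> a))"

definition axis_rel :: "'f \<Rightarrow> 'f \<Rightarrow> ('a \<times> 'a) set" where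
  "axis_rel l d = {(a, b). a \<in> noncentral_axes l d \<and> b \<in> noncentral_axes l d \<and>
     (a = b \<or> a \<odot> b \<noteq> b \<odot> a)}"

lemma noncommuting_same_type:
  assumes "a \<in> noncentral_axes l d" "b \<in> noncentral_axes l d" "a \<odot> b \<noteq> b \<odot> a"
  shows "b - a \<in> odd_part l d a"
  using noncommuting_axes[of l d a l d b] assms by (auto simp: noncentral_axes_def)

text \<open>For a related \<open>b = a + v\<close> with \<open>v\<close> odd,
  \<open>l *s (a \<odot> b) - d *s (b \<odot> a)\<close> is \<open>l - d\<close> times
  \<open>a + (l + d) *s v\<close>, and \<open>l + d = 1\<close>. Otherwise both products vanish by
  \<open>commuting_axes\<close>.\<close>

lemma axis_proj_axis:
  assumes full: "span axes = UNIV" and a: "a \<in> noncentral_axes l d" and b: "b \<in> noncentral_axes l d"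
  shows "axis_proj l d a b = (if (a, b) \<in> axis_rel l d then b else 0)"
proof -
  have typed: "typed_axis l d a" "typed_axis l d b" using a b by (auto simp: noncentral_axes_def)
  have ld: "l \<noteq> d" "l + d = 1" using noncentral_type[OF full a] by auto
  show ?thesis
  proof (cases "(a, b) \<in> axis_rel l d")
    case True
    define v where "v = b - a"
    then have b_eq: "b = a + v" by simp
    have v: "a \<odot> v = l *s v" "v \<odot> a = d *s v"
      using True noncommuting_same_type[OF a b] unfolding v_def axis_rel_def eigenspace_def by auto
    have "l *s (a \<odot> b) - d *s (b \<odot> a) = (l - d) *s a + ((l - d) * (l + d)) *s v"
      using v typed_axisD[OF typed(1)] unfolding b_eq by (simp add: mult_linear algebra_simps)
    then have "axis_proj l d a b = a + v"
      using ld by (simp add: axis_proj_def scale_right_distrib)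
    then show ?thesis using True by (simp add: v_def)
  next
    case False
    then have "a \<noteq> b" "a \<odot> b = b \<odot> a" using a b by (auto simp: axis_rel_def)
    then have "a \<odot> b = 0" "b \<odot> a = 0" using commuting_axes[OF typed ld(1)] by auto
    then show ?thesis using False by (simp add: axis_proj_def)
  qed
qed

text \<open>For transitivity, let \<open>b = a + v\<close> and \<open>c = a + w\<close> be related
  to \<open>a\<close>. If \<open>b\<close> and \<open>c\<close> commute, then
  \<open>v \<odot> w - w \<odot> v = (l - d) *s (v - w)\<close> is both even and odd, hence zero, so
  \<open>b = c\<close>.\<close>

lemma equiv_axis_rel: 
  assumes "span axes = UNIV"
  shows "equiv (noncentral_axes l d) (axis_rel l d)"
proof (rule equivI)
  show "axis_rel l d \<subseteq> noncentral_axes l d \<times> noncentral_axes l d"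
    by (auto simp: axis_rel_def)
  show "refl_on (noncentral_axes l d) (axis_rel l d)"
    by (auto simp: refl_on_def axis_rel_def)
  show sym: "sym (axis_rel l d)"
    by (auto simp: sym_def axis_rel_def)
  have comm: "(b, c) \<in> axis_rel l d" if "(a, b) \<in> axis_rel l d" "(a, c) \<in> axis_rel l d" for a b c
  proof (rule ccontr)
    assume not: "(b, c) \<notin> axis_rel l d"
    have mem: "a \<in> noncentral_axes l d" "b \<in> noncentral_axes l d" "c \<in> noncentral_axes l d"
      using that by (auto simp: axis_rel_def)
    then have a: "typed_axis l d a" by (simp add: noncentral_axes_def)
    define v w where "v = b - a" and "w = c - a"
    have vw: "v \<in> odd_part l d a" "w \<in> odd_part l d a"
      using that noncommuting_same_type[OF mem(1)] mem subspace_0[OF subspace_odd_part]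
      by (auto simp: v_def w_def axis_rel_def)
    then have eig: "a \<odot> v = l *s v" "v \<odot> a = d *s v" "a \<odot> w = l *s w" "w \<odot> a = d *s w"
      by (auto simp: eigenspace_def)
    have "(a + v) \<odot> (a + w) = (a + w) \<odot> (a + v)"
      using not mem by (simp add: axis_rel_def v_def w_def)
    then have "v \<odot> w - w \<odot> v = (l - d) *s (v - w)"
      using eig by (simp add: mult_linear algebra_simps)
    moreover have "v \<odot> w - w \<odot> v \<in> even_part UNIV a" "(l - d) *s (v - w) \<in> odd_part l d a"
      using fusion(4)[OF a] vw subspace_diff[OF subspace_even_part]
        subspace_diff[OF subspace_odd_part] subspace_scale[OF subspace_odd_part] by auto
    ultimately have "(l - d) *s (v - w) = 0" using even_odd_zero[OF a] by metis
    then have "b = c" using noncentral_type[OF assms mem(1)] by (simp add: v_def w_def)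
    then show False using not mem by (simp add: axis_rel_def)
  qed
  show "trans (axis_rel l d)"
    using comm symD[OF sym] by (intro transI) blast
qed

lemma axis_proj_linear:
  "axis_proj l d a (x + y) = axis_proj l d a x + axis_proj l d a y"
  "axis_proj l d a (c *s x) = c *s axis_proj l d a x"
  "axis_proj l d a 0 = 0"
  by (simp_all add: axis_proj_def mult_linear algebra_simps)

text \<open>Write \<open>x\<close> as a combination of finitely many axes and let \<open>F\<close>
  contain one representative of each of their classes. Each of these axes is related to exactly one
  representative, so the sum of the projections fixes it, and hence fixes \<open>x\<close>.\<close>

lemma span_axis_proj:
  assumes full: "span axes = UNIV" and x: "x \<in> span (noncentral_axes l d)"
  obtains F where "F \<subseteq> noncentral_axes l d" "x = (\<Sum>a\<in>F. axis_proj l d a x)"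
proof -
  let ?S = "noncentral_axes l d" and ?R = "axis_rel l d"
  note eq = equiv_axis_rel[OF full, of l d]
  obtain T where T: "finite T" "T \<subseteq> ?S" "x \<in> span T"
  proof -
    obtain T r where "finite T" "T \<subseteq> ?S" "x = (\<Sum>a\<in>T. r a *s a)"
      using x unfolding span_explicit by blast
    moreover have "(\<Sum>a\<in>T. r a *s a) \<in> span T"
      by (intro span_sum span_scale span_base)
    ultimately show thesis using that by blast
  qed
  define rep where "rep b = (SOME a. (a, b) \<in> ?R)" for b
  have rep: "(rep b, b) \<in> ?R" if "b \<in> ?S" for b
  proof -
    have "(b, b) \<in> ?R" using that by (simp add: axis_rel_def)
    then show ?thesis unfolding rep_def by (rule someI)
  qed
  \<comment> \<open>Related axes have the same related axes, so the choice operator picks the same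
    representative for both.\<close>
  have rep_eq: "rep b = rep c" if "(b, c) \<in> ?R" for b c
  proof -
    have "(a, b) \<in> ?R \<longleftrightarrow> (a, c) \<in> ?R" for a
      using that eq unfolding equiv_def by (meson symD transD)
    then show ?thesis by (simp add: rep_def)
  qed
  define F where "F = rep ` T"
  have F: "F \<subseteq> ?S" using rep T by (auto simp: F_def axis_rel_def)
  have "T \<subseteq> {y. y = (\<Sum>a\<in>F. axis_proj l d a y)}"
  proof
    fix b assume b: "b \<in> T"
    then have bS: "b \<in> ?S" using T by auto
    have "(a, b) \<in> ?R \<longleftrightarrow> a = rep b" if a: "a \<in> F" for a
    proof
      assume "(a, b) \<in> ?R"
      moreover obtain c where "c \<in> T" "a = rep c" using a by (auto simp: F_def)
      moreover from this have "rep a = rep c" using rep_eq[OF rep] T by auto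
      ultimately show "a = rep b" using rep_eq by metis
    qed (use rep bS in auto)
    then have "(\<Sum>a\<in>F. axis_proj l d a b) = (\<Sum>a\<in>F. if a = rep b then b else 0)"
      using axis_proj_axis[OF full _ bS] F by (intro sum.cong) auto
    also have "\<dots> = b" using T b by (simp add: F_def)
    finally show "b \<in> {y. y = (\<Sum>a\<in>F. axis_proj l d a y)}" by simp
  qed
  moreover have "subspace {y. y = (\<Sum>a\<in>F. axis_proj l d a y)}"
    by (rule subspaceI) (simp_all add: axis_proj_linear sum.distrib flip: scale_sum_right)
  ultimately have "span T \<subseteq> {y. y = (\<Sum>a\<in>F. axis_proj l d a y)}"
    by (rule span_minimal)
  then show thesis using that F T by blast
qed

text \<open>
  The general \<open>W\<close> allows a two-step argument for an annihilating \<open>p + q\<close> with \<open>p\<close>, \<open>q\<close> spanned by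
  axes of opposite types: first \<open>q\<close> is moved into the span containing \<open>p\<close>, then \<open>W = {0}\<close> applies.
\<close>

lemma mem_subspace_if_products:
  assumes "span axes = UNIV" "x \<in> span (noncentral_axes l d)" "subspace W"
    and "\<And>a. a \<in> noncentral_axes l d \<Longrightarrow> a \<odot> x \<in> W \<and> x \<odot> a \<in> W"
  shows "x \<in> W"
proof -
  obtain F where "F \<subseteq> noncentral_axes l d" "x = (\<Sum>a\<in>F. axis_proj l d a x)"
    using span_axis_proj[OF assms(1,2)] .
  moreover have "axis_proj l d a x \<in> W" if "a \<in> noncentral_axes l d" for a
    unfolding axis_proj_def
    using assms(4)[OF that] assms(3) by (intro subspace_scale subspace_diff) auto
  ultimately show ?thesis using subspace_sum[OF assms(3), of F "\<lambda>a. axis_proj l d a x"] by auto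
qed

lemma noncentral_miyamoto:
  assumes "typed_axis l d a" "b \<in> noncentral_axes l' d'"
  shows "miyamoto l a b \<in> noncentral_axes l' d'"
  using assms typed_axis_miyamoto central_miyamoto by (simp add: noncentral_axes_def)

text \<open>
  For axes of opposite type the even component vanishes, so the product is an odd component, which
  lies in the span of either of the two types.
\<close>

lemma opposite_type_mult:
  assumes two: "(2::'f) \<noteq> 0" and full: "span axes = UNIV"
    and a: "a \<in> noncentral_axes d l" and x: "x \<in> span (noncentral_axes l d)"
  shows "a \<odot> x \<in> span (noncentral_axes l d) \<and> x \<odot> a \<in> span (noncentral_axes l d)"
proof -
  let ?S = "noncentral_axes l d"
  have ta: "typed_axis d l a" "\<not> central a" using a by (auto simp: noncentral_axes_def)
  have ld: "d \<noteq> l" using noncentral_type[OF full a] by auto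
  have gen: "a \<odot> b \<in> span ?S \<and> b \<odot> a \<in> span ?S" if b: "b \<in> ?S" for b
  proof -
    have tb: "typed_axis l d b" using b by (auto simp: noncentral_axes_def)
    have "a \<noteq> b" using type_unique[OF ta(1)] ta(2) tb ld unfolding central_def by blast
    have odd: "odd_component d a b \<in> span ?S"
      using odd_component_span[OF two b] noncentral_miyamoto[OF ta(1) b] .
    show ?thesis
    proof (cases "a \<odot> b = b \<odot> a")
      case True
      then show ?thesis using commuting_axes[OF ta(1) tb ld] \<open>a \<noteq> b\<close> by (simp add: span_zero)
    next
      case False
      then show ?thesis using noncommuting_axes[OF ta(1) tb] ld odd by (auto intro: span_scale)
    qed
  qed
  have "a \<in> span {a}" by (simp add: span_base)
  then show ?thesis
    using span_mult_induct[OF _ x subspace_span, of a "{a}" ?S] gen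
      span_mult_induct[OF x _ subspace_span, of a "{a}" ?S] by simp
qed

section \<open>Annihilators of the noncentral factors\<close>

text \<open>Both orders of the pair are joined because axes of opposite types may fail to commute,
  so the spans of the two types need not annihilate each other.\<close>

definition noncentral_factor :: "'f \<Rightarrow> 'f \<Rightarrow> 'a set" where
  "noncentral_factor l d = span (noncentral_axes l d \<union> noncentral_axes d l)"

text \<open>For \<open>a\<close> of type \<open>(d, l)\<close>, the product
  \<open>a \<odot> q = - (a \<odot> p)\<close> lies in the span of the axes of type
  \<open>(l, d)\<close> by \<open>opposite_type_mult\<close>. Hence so does \<open>q\<close>, and
  \<open>x\<close> lies in the span of a single type, where vanishing products force it to be
  zero.\<close>

lemma noncentral_factor_annihilator:
  assumes two: "(2::'f) \<noteq> 0" and full: "span axes = UNIV"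
    and x: "x \<in> noncentral_factor l d" and ann: "\<And>y. x \<odot> y = 0 \<and> y \<odot> x = 0"
  shows "x = 0"
proof -
  obtain p q where pq: "x = p + q" "p \<in> span (noncentral_axes l d)" "q \<in> span (noncentral_axes d l)"
    using x by (auto simp: noncentral_factor_def span_Un)
  have "a \<odot> q \<in> span (noncentral_axes l d) \<and> q \<odot> a \<in> span (noncentral_axes l d)"
    if a: "a \<in> noncentral_axes d l" for a
  proof -
    have "a \<odot> q = - (a \<odot> p)" "q \<odot> a = - (p \<odot> a)"
      using ann[of a] pq(1) by (simp_all add: mult_linear eq_neg_iff_add_eq_0 add.commute)
    then show ?thesis using opposite_type_mult[OF two full a pq(2)] by (simp add: span_neg)
  qed
  then have "q \<in> span (noncentral_axes l d)"
    using mem_subspace_if_products[OF full pq(3) subspace_span] by blast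
  then have "x \<in> span (noncentral_axes l d)" using pq by (simp add: span_add)
  then have "x \<in> {0}"
    using mem_subspace_if_products[OF full _ subspace_single_0] ann by blast
  then show ?thesis by simp
qed

section \<open>A criterion for direct products\<close>

text \<open>If components sum to zero, multiplying the sum by an element of one factor leaves only
  the component in that factor. So each component outside \<open>C\<close> annihilates the whole
  algebra and is zero by \<open>ann\<close>, and the sum reduces to the component at
  \<open>C\<close>. Surjectivity holds because the image of the sum map is a subspace containing
  every factor.\<close>

lemma direct_productI:
  assumes sub: "\<And>S. S \<in> \<F> \<Longrightarrow> subalgebra S"
    and orth: "\<And>S T x y. S \<in> \<F> \<Longrightarrow> T \<in> \<F> \<Longrightarrow> S \<noteq> T \<Longrightarrow> x \<in> S \<Longrightarrow> y \<in> T \<Longrightarrow> x \<odot> y = 0"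
    and full: "span (\<Union>\<F>) = UNIV"
    and ann: "\<And>S x. S \<in> \<F> \<Longrightarrow> S \<noteq> C \<Longrightarrow> x \<in> S \<Longrightarrow> (\<And>y. x \<odot> y = 0 \<and> y \<odot> x = 0) \<Longrightarrow> x = 0"
  shows "direct_product UNIV \<F>"
proof -
  define \<Phi> where "\<Phi> = {f. (\<forall>S\<in>\<F>. f S \<in> S) \<and> (\<forall>S. S \<notin> \<F> \<longrightarrow> f S = 0) \<and> finite {S. f S \<noteq> (0::'a)}}"
  define \<sigma> where "\<sigma> f = (\<Sum>S | f S \<noteq> 0. f S)" for f :: "'a set \<Rightarrow> 'a"
  have subsp: "subspace S" if "S \<in> \<F>" for S using sub[OF that] by (simp add: subalgebra_def)
  have \<sigma>_eq: "\<sigma> f = (\<Sum>S\<in>K. f S)" if "finite K" "{S. f S \<noteq> 0} \<subseteq> K" for f K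
    unfolding \<sigma>_def using that by (intro sum.mono_neutral_left) auto
  have add: "(\<lambda>S. f S + g S) \<in> \<Phi> \<and> \<sigma> (\<lambda>S. f S + g S) = \<sigma> f + \<sigma> g" if "f \<in> \<Phi>" "g \<in> \<Phi>" for f g
  proof -
    let ?K = "{S. f S \<noteq> 0} \<union> {S. g S \<noteq> 0}"
    have fin: "finite ?K" using that by (simp add: \<Phi>_def)
    have supp: "{S. f S + g S \<noteq> 0} \<subseteq> ?K" by auto
    have "\<sigma> (\<lambda>S. f S + g S) = \<sigma> f + \<sigma> g"
      using \<sigma>_eq[OF fin supp] \<sigma>_eq[OF fin, of f] \<sigma>_eq[OF fin, of g] by (simp add: sum.distrib)
    moreover have "(\<lambda>S. f S + g S) \<in> \<Phi>"
      using that finite_subset[OF supp fin] by (auto simp: \<Phi>_def intro: subspace_add[OF subsp])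
    ultimately show ?thesis by blast
  qed
  have scale: "(\<lambda>S. c *s f S) \<in> \<Phi> \<and> \<sigma> (\<lambda>S. c *s f S) = c *s \<sigma> f" if "f \<in> \<Phi>" for c f
  proof -
    let ?K = "{S. f S \<noteq> 0}"
    have fin: "finite ?K" using that by (simp add: \<Phi>_def)
    have supp: "{S. c *s f S \<noteq> 0} \<subseteq> ?K" by auto
    have "\<sigma> (\<lambda>S. c *s f S) = c *s \<sigma> f"
      using \<sigma>_eq[OF fin supp] \<sigma>_eq[OF fin, of f] by (simp add: scale_sum_right)
    moreover have "(\<lambda>S. c *s f S) \<in> \<Phi>"
      using that finite_subset[OF supp fin] by (auto simp: \<Phi>_def intro: subspace_scale[OF subsp])
    ultimately show ?thesis by blast
  qed
  have zero_if_sum_zero: "h = (\<lambda>S. 0)" if h: "h \<in> \<Phi>" "\<sigma> h = 0" for h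
  proof -
    let ?K = "{S. h S \<noteq> 0}"
    have fin: "finite ?K" using h by (simp add: \<Phi>_def)
    have mem: "h S \<in> S" if "S \<in> \<F>" for S using that h by (simp add: \<Phi>_def)
    have K: "?K \<subseteq> \<F>" using h by (auto simp: \<Phi>_def)
    have sum0: "(\<Sum>S\<in>?K. h S) = 0" using h(2) by (simp add: \<sigma>_def)
    have other: "h S = 0" if "S \<noteq> C" for S
    proof (rule ccontr)
      assume S: "h S \<noteq> 0"
      then have SF: "S \<in> \<F>" using K by auto
      have "h S \<odot> y = 0 \<and> y \<odot> h S = 0" if "y \<in> \<Union>\<F>" for y
      proof -
        obtain T where T: "T \<in> \<F>" "y \<in> T" using \<open>y \<in> \<Union>\<F>\<close> by blast
        show ?thesis
        proof (cases "T = S")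
          case False
          then show ?thesis using orth T SF mem by blast
        next
          case True
          have off: "h U \<odot> y = 0 \<and> y \<odot> h U = 0" if "U \<in> ?K - {S}" for U
            using that K mem orth T True by blast
          have "0 = (\<Sum>U\<in>?K. h U) \<odot> y" "0 = y \<odot> (\<Sum>U\<in>?K. h U)" using sum0 by simp_all
          then have "0 = (\<Sum>U\<in>?K. h U \<odot> y)" "0 = (\<Sum>U\<in>?K. y \<odot> h U)"
            by (simp_all only: mult_sum_left mult_sum_right)
          moreover have "(\<Sum>U\<in>?K. h U \<odot> y) = h S \<odot> y" "(\<Sum>U\<in>?K. y \<odot> h U) = y \<odot> h S"
            using fin S off by (simp_all add: sum.remove[of ?K S])
          ultimately show ?thesis by simp
        qed
      qed
      moreover have "subspace {y. h S \<odot> y = 0 \<and> y \<odot> h S = 0}"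
        by (rule subspaceI) (auto simp: mult_linear)
      ultimately have "span (\<Union>\<F>) \<subseteq> {y. h S \<odot> y = 0 \<and> y \<odot> h S = 0}"
        by (intro span_minimal) auto
      then have "h S \<odot> y = 0 \<and> y \<odot> h S = 0" for y
        using full by auto
      then show False using ann[OF SF that mem[OF SF]] S by blast
    qed
    have "\<sigma> h = (\<Sum>S\<in>{C}. h S)"
      using other by (intro \<sigma>_eq) auto
    then have "h C = 0" using h(2) by simp
    with other show ?thesis by (metis (no_types))
  qed
  have "inj_on \<sigma> \<Phi>"
  proof (rule inj_onI)
    fix f g assume fg: "f \<in> \<Phi>" "g \<in> \<Phi>" "\<sigma> f = \<sigma> g"
    \<comment> \<open>The difference is written with addition and scaling, for which closure of
      \<open>\<Phi>\<close> and linearity of \<open>\<sigma>\<close> are available.\<close>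
    have "(\<lambda>S. f S + (-1) *s g S) = (\<lambda>S. 0)"
      using zero_if_sum_zero add[OF fg(1) conjunct1[OF scale[OF fg(2), of "-1"]]] scale[OF fg(2), of "-1"] fg(3)
      by simp
    then show "f = g"
      by (auto simp: fun_eq_iff)
  qed
  moreover have "\<sigma> ` \<Phi> = UNIV"
  proof -
    have "\<Union>\<F> \<subseteq> \<sigma> ` \<Phi>"
    proof
      fix x assume "x \<in> \<Union>\<F>"
      then obtain S where S: "S \<in> \<F>" "x \<in> S" by blast
      let ?f = "\<lambda>T. if T = S then x else 0"
      have supp: "{T. ?f T \<noteq> 0} \<subseteq> {S}" by auto
      have "?f \<in> \<Phi>"
        using S finite_subset[OF supp] subspace_0[OF subsp] by (auto simp: \<Phi>_def)
      moreover have "\<sigma> ?f = x" using \<sigma>_eq[OF _ supp] by simp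
      ultimately show "x \<in> \<sigma> ` \<Phi>" by force
    qed
    moreover have "subspace (\<sigma> ` \<Phi>)"
    proof (rule subspaceI)
      have "(\<lambda>S. 0) \<in> \<Phi>" "\<sigma> (\<lambda>S. 0) = 0"
        using subspace_0[OF subsp] by (auto simp: \<Phi>_def \<sigma>_def)
      then show "0 \<in> \<sigma> ` \<Phi>" by force
      show "x + y \<in> \<sigma> ` \<Phi>" if "x \<in> \<sigma> ` \<Phi>" "y \<in> \<sigma> ` \<Phi>" for x y
        using that add by (smt (verit) imageE image_eqI)
      show "c *s x \<in> \<sigma> ` \<Phi>" if "x \<in> \<sigma> ` \<Phi>" for c x
        using that scale by (smt (verit) imageE image_eqI)
    qed
    ultimately have "span (\<Union>\<F>) \<subseteq> \<sigma> ` \<Phi>" by (rule span_minimal)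
    then show ?thesis using full by auto
  qed
  ultimately have "bij_betw \<sigma> \<Phi> UNIV" by (simp add: bij_betw_def)
  then show ?thesis
    using sub orth unfolding direct_product_def \<Phi>_def \<sigma>_def by blast
qed

section \<open>Assembling the factors\<close>

lemma axis_span_subalgebra:
  assumes two: "(2::'f) \<noteq> 0" and "X \<subseteq> axes"
    and inv: "\<And>l d a b. typed_axis l d a \<Longrightarrow> b \<in> X \<Longrightarrow> miyamoto l a b \<in> X"
  shows "subalgebra (span X)"
proof (rule subalgebra_span)
  fix a b assume ab: "a \<in> X" "b \<in> X"
  then obtain l d where a: "typed_axis l d a" using assms(2) by (auto simp: axes_def)
  show "a \<odot> b \<in> span X" by (rule axis_mult_span[OF two a ab inv[OF a ab(2)]])
qed

text \<open>If \<open>a\<close> and \<open>b\<close> did not commute, \<open>b\<close> would be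
  noncentral of the same or the opposite type and so belong to the excluded set. Hence they commute,
  and \<open>commuting_axes\<close> applies.\<close>

lemma orthogonal_noncentral:
  assumes full: "span axes = UNIV" and a: "a \<in> noncentral_axes l d \<union> noncentral_axes d l"
    and b: "b \<in> axes" "b \<notin> noncentral_axes l d \<union> noncentral_axes d l"
  shows "a \<odot> b = 0 \<and> b \<odot> a = 0"
proof -
  obtain l' d' where tb: "typed_axis l' d' b" using b by (auto simp: axes_def)
  obtain l1 d1 where a1: "a \<in> noncentral_axes l1 d1" "l1 = l \<and> d1 = d \<or> l1 = d \<and> d1 = l"
    using a by blast
  then have ta: "typed_axis l1 d1 a" by (simp add: noncentral_axes_def)
  have "a \<odot> b = b \<odot> a"
  proof (rule ccontr)
    assume ne: "a \<odot> b \<noteq> b \<odot> a"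
    then have "\<not> central b" unfolding central_def by metis
    then have "b \<in> noncentral_axes l' d'" using tb by (simp add: noncentral_axes_def)
    moreover have "l' = l1 \<and> d' = d1 \<or> l' = d1 \<and> d' = l1"
      using noncommuting_axes[OF ta tb ne] by blast
    ultimately show False using b(2) a1(2) by auto
  qed
  moreover have "a \<noteq> b" using a b by blast
  ultimately show ?thesis
    using commuting_axes[OF ta tb] noncentral_type[OF full a1(1)] by simp
qed

lemma PAJ_direct_product:
  assumes two: "(2::'f) \<noteq> 0" and typing: "axis_typing UNIV ty" and PAJ: "PAJ UNIV"
  shows "\<exists>\<N> C. C \<notin> \<N> \<and> (\<forall>N\<in>\<N>. uniform_noncomm_PAJ ty N) \<and> CPAJ C \<and>
    direct_product UNIV (insert C \<N>)"
proof -
  note full = PAJ_span_axes[OF two PAJ]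
  define X where "X l d = noncentral_axes l d \<union> noncentral_axes d l" for l d
  define Z where "Z = {a \<in> axes. central a}"
  define C where "C = span Z"
  \<comment> \<open>Nonemptiness makes the pair admissible by \<open>noncentral_type\<close> and
    keeps each member different from \<open>C\<close>. The pairs \<open>(l, d)\<close> and
    \<open>(d, l)\<close> give the same member.\<close>
  define \<N> where "\<N> = {span (X l d) | l d. X l d \<noteq> {}}"
  have X_axes: "X l d \<subseteq> axes" for l d
    by (auto simp: X_def noncentral_axes_def axes_def)
  have subX: "subalgebra (span (X l d))" for l d
    using X_axes noncentral_miyamoto by (intro axis_span_subalgebra[OF two]) (auto simp: X_def)
  have subC: "subalgebra C"
    unfolding C_def
    by (rule axis_span_subalgebra[OF two])
      (auto simp: Z_def axes_def central_miyamoto intro: typed_axis_miyamoto)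
  have central_C: "x \<odot> y = y \<odot> x" if "x \<in> C" for x y
  proof -
    have "subspace {x. \<forall>y. x \<odot> y = y \<odot> x}" by (rule subspaceI) (auto simp: mult_linear)
    then have "C \<subseteq> {x. \<forall>y. x \<odot> y = y \<odot> x}"
      unfolding C_def by (rule span_minimal[rotated]) (auto simp: Z_def central_def)
    then show ?thesis using that by blast
  qed
  have X_type: "l \<noteq> d \<and> l + d = 1" if "X l d \<noteq> {}" for l d
    using that noncentral_type[OF full, of _ l d] noncentral_type[OF full, of _ d l]
    by (auto simp: X_def add.commute)
  have C_notin: "C \<notin> \<N>"
  proof
    assume "C \<in> \<N>"
    then obtain l d a where "C = span (X l d)" "a \<in> X l d" by (auto simp: \<N>_def)
    then have "a \<in> C" "\<not> central a" by (auto simp: span_base X_def noncentral_axes_def)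
    then show False using central_C by (auto simp: central_def)
  qed
  have "uniform_noncomm_PAJ ty N" if NN: "N \<in> \<N>" for N
  proof -
    obtain l d where N: "N = span (X l d)" "X l d \<noteq> {}" using NN by (auto simp: \<N>_def)
    have "primitive_axis N (fst (ty a)) (snd (ty a)) a \<and> ty a \<in> {(l, d), (d, l)}" if a: "a \<in> X l d" for a
    proof -
      obtain l' d' where a': "typed_axis l' d' a" "\<not> central a" "(l', d') \<in> {(l, d), (d, l)}"
        using a by (auto simp: X_def noncentral_axes_def)
      have ty: "typed_axis (fst (ty a)) (snd (ty a)) a"
        using typing a'(1) unfolding axis_typing_def by blast
      \<comment> \<open>The typing \<open>ty\<close> must select the type \<open>(l', d')\<close>,
        since a noncentral axis has only one.\<close>
      obtain x where "a \<odot> x \<noteq> x \<odot> a" using a'(2) unfolding central_def by blast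
      then have "l' = fst (ty a) \<and> d' = snd (ty a)"
        by (rule type_unique[OF a'(1) ty])
      then have "ty a = (l', d')" by (simp add: prod_eq_iff)
      moreover have "a \<in> N" using a N by (simp add: span_base)
      ultimately show ?thesis
        using typed_axis_restrict[OF ty] subX N a'(3) by simp
    qed
    then show ?thesis
      unfolding uniform_noncomm_PAJ_def
      using X_type[OF N(2)] subX[of l d] hull_eq_span[OF subX[of l d]] N(1) by blast
  qed
  moreover have "CPAJ C"
  proof -
    have "\<exists>l d. primitive_axis C l d a" if "a \<in> Z" for a
      using that typed_axis_restrict[OF _ subC] span_base[OF that] unfolding Z_def axes_def C_def by blast
    then show ?thesis
      using subC hull_eq_span[OF subC[unfolded C_def]] central_C unfolding CPAJ_def PAJ_def C_def by blast
  qed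
  moreover have "direct_product UNIV (insert C \<N>)"
  proof (rule direct_productI)
    show "subalgebra S" if "S \<in> insert C \<N>" for S
      using that subC subX by (auto simp: \<N>_def)
    have span_orth: "x \<odot> y = 0 \<and> y \<odot> x = 0"
      if "x \<in> span (X l d)" "y \<in> span Y" "Y \<subseteq> axes" "Y \<inter> X l d = {}" for x y l d Y
    proof -
      have gen: "a \<odot> b = 0 \<and> b \<odot> a = 0" if "a \<in> X l d" "b \<in> Y" for a b
        using orthogonal_noncentral[OF full, of a l d b] that \<open>Y \<subseteq> axes\<close> \<open>Y \<inter> X l d = {}\<close>
        unfolding X_def by blast
      then show ?thesis
        using span_mult_induct[OF that(1,2) subspace_single_0] span_mult_induct[OF that(2,1) subspace_single_0]
        by auto
    qed
    show "x \<odot> y = 0"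
      if ST: "S \<in> insert C \<N>" "T \<in> insert C \<N>" "S \<noteq> T" "x \<in> S" "y \<in> T" for S T x y
    proof -
      have disjZ: "Z \<inter> X l d = {}" for l d by (auto simp: Z_def X_def noncentral_axes_def)
      \<comment> \<open>A shared noncentral axis has a single type, so the unordered pairs coincide,
        and with them the spans.\<close>
      have disj: "X l' d' \<inter> X l d = {}" if "span (X l d) \<noteq> span (X l' d')" for l d l' d'
      proof (rule ccontr)
        assume "\<not> ?thesis"
        then obtain a where a: "a \<in> X l' d'" "a \<in> X l d" by blast
        have uniq: "l1 = l2 \<and> d1 = d2"
          if "a \<in> noncentral_axes l1 d1" "a \<in> noncentral_axes l2 d2" for l1 d1 l2 d2
          using that type_unique[of l1 d1 a l2 d2] by (auto simp: noncentral_axes_def central_def)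
        have "X l d = X l' d'"
          using a uniq unfolding X_def by blast
        then show False using that by simp
      qed
      show ?thesis
      proof (cases "S = C")
        case True
        then obtain l d where "T = span (X l d)" using ST by (auto simp: \<N>_def)
        then show ?thesis using span_orth[of y l d x Z] disjZ ST True by (auto simp: C_def Z_def)
      next
        case False
        then obtain l d where S: "S = span (X l d)" using ST by (auto simp: \<N>_def)
        show ?thesis
        proof (cases "T = C")
          case True
          then show ?thesis using span_orth[of x l d y Z] disjZ ST S by (auto simp: C_def Z_def)
        next
          case False
          then obtain l' d' where "T = span (X l' d')" using ST by (auto simp: \<N>_def)
          then show ?thesis using span_orth[of x l d y "X l' d'"] disj X_axes ST S by metis
        qed
      qed
    qed
    have "a \<in> \<Union>(insert C \<N>)" if a: "a \<in> axes" for a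
    proof (cases "central a")
      case True
      then show ?thesis using that by (simp add: C_def Z_def span_base)
    next
      case False
      then obtain l d where "a \<in> X l d" using a by (auto simp: axes_def X_def noncentral_axes_def)
      then have "a \<in> span (X l d)" "span (X l d) \<in> \<N>" by (auto simp: span_base \<N>_def)
      then show ?thesis by blast
    qed
    then have "axes \<subseteq> \<Union>(insert C \<N>)" by blast
    then show "span (\<Union>(insert C \<N>)) = UNIV" using span_mono full by blast
    show "x = 0" if S: "S \<in> insert C \<N>" "S \<noteq> C" and "x \<in> S" "\<And>y. x \<odot> y = 0 \<and> y \<odot> x = 0" for S x
    proof -
      obtain l d where "S = noncentral_factor l d"
        using S by (auto simp: \<N>_def noncentral_factor_def X_def)
      then show ?thesis using noncentral_factor_annihilator[OF two full] that by blast
    qed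
  qed
  ultimately show ?thesis using C_notin by blast
qed

end

theorem theoremD:
  fixes scale :: "'f::field \<Rightarrow> 'a::ab_group_add \<Rightarrow> 'a"
    and mult :: "'a \<Rightarrow> 'a \<Rightarrow> 'a"
    and ty :: "'a \<Rightarrow> 'f \<times> 'f"
  assumes "nonassoc_algebra scale mult"
    and "(2::'f) \<noteq> 0"
    and "nonassoc_algebra.axis_typing scale mult UNIV ty"
    and "nonassoc_algebra.PAJ scale mult UNIV"
  shows "\<exists>\<N> C. C \<notin> \<N> \<and>
      (\<forall>N\<in>\<N>. nonassoc_algebra.uniform_noncomm_PAJ scale mult ty N) \<and>
      nonassoc_algebra.CPAJ scale mult C \<and>
      nonassoc_algebra.direct_product scale mult UNIV (insert C \<N>)"
  using nonassoc_algebra.PAJ_direct_product[OF assms] .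

end
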